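(* Let $\mathcal P$ be a collection of homogeneous graph properties, let $f_1,\dots,f_s$ be additive functions on graphs, and let $\omega=(\omega_1,\omega_2,\dots)\in\mathbb Q^{\infty}$ be a weight vector. For $n\ge 1$ and integers $k_1,\dots,k_s$ let $g_{n,k_1,\dots,k_s}$ be the number of connected graphs $G$ on the vertex set $[n]=\{1,\dots,n\}$ that satisfy the properties $\mathcal P$ and have $f_i(G)=k_i$ for $i=1,\dots,s$. Put $$\tilde g(x,y,z)=\sum_{n\ge 1,\;k_1,\dots,k_s} g_{n,k_1,\dots,k_s}\,\frac{1}{n!}\,x^n\prod_{i=1}^s y_i^{k_i}\,z_n ,$$ a formal series in $x$, $y_1,\dots,y_s$ and infinitely many variables $z_1,z_2,\dots$. Then the number of graphs with properties $\mathcal P$, of given order, given values of the $f_i$ and given $\omega$-weighted number of connected components $h_0^\omega$ is generated by $\tau_\omega(\exp\tilde g)$. That is, if $$\tau_\omega(\exp\tilde g)=\sum_{n,k,\nu} T_{n,k,\nu}\,\frac{1}{n!}\,x^n y^k z^\nu,\qquad k=(k_1,\dots,k_s),\quad y^k=\prod_{i=1}^s y_i^{k_i},$$ then $T_{n,k,\nu}$ is precisely the number of graphs $G$ on $[n]$ with properties $\mathcal P$, with $f_i(G)=k_i$ for all $i=1,\dots,s$, and with $h_0^\omega(G)=\nu$.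
   Context: All graphs are finite, simple and labeled. The order of a graph is its number of vertices; $|G|$ denotes the order of $G$. Graph properties and functions on graphs are understood to be invariant under relabeling of vertices. An integer-valued function $f$ on the set of graphs is additive if $f(G+G')=f(G)+f(G')$ for any two graphs $G,G'$ with disjoint vertex sets, where $G+G'$ is the disjoint union. A graph property $P$ is homogeneous if, whenever a graph $G$ satisfies $P$, all of the connected components of $G$ satisfy $P$. The $\omega$-weighted number of connected components of a graph $G$ with connected components $G_1,\dots,G_r$ is $h_0^\omega(G)=\sum_{i=1}^r\omega_{|G_i|}$. In particular, for $\omega=(1,1,1,\dots)$ it is the number of connected components. The graph with no vertices ($n=0$) is counted once by convention, with all $f_i$ equal to $0$, with $h_0^\omega=0$, and as satisfying all the properties; it corresponds to the constant term $1$. $\tau_\omega:\mathbb Q[z_1,z_2,\dots]\to\overline{\mathbb Q(z)}$ is the ring homomorphism determined by $\prod_i z_i^{\alpha_i}\mapsto z^{\sum_i\omega_i\alpha_i}$ (so $z_i\mapsto z^{\omega_i}$), where $\overline{\mathbb Q(z)}$ is the algebraic closure of the function field $\mathbb Q(z)$, and computations with fractional powers of $z$ are done purely symbolically. It is extended by replacing the coefficient ring $\mathbb Q$ with $\mathbb Q[x,y_1,\dots,y_s]$, so that it fixes $x$ and the $y_i$, and it is applied coefficientwise to formal power series in $x$.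
   Formalization: Each property in P is also assumed to satisfy the converse of homogeneity: if all connected components of G satisfy P, so does G. Without it the claim fails, e.g. for P = "connected" (coefficient of x^2 z^2). *)

theory Defs
  imports
    "Graph_Theory.Graph_Theory"
    "HOL-Library.Poly_Mapping"
    "HOL-Library.Product_Plus"
    "HOL-Computational_Algebra.Formal_Power_Series"
begin

text \<open>
  A finite simple graph is a finite loop-free symmetric digraph without parallel arcs, i.e.\ a
  \<^locale>\<open>pair_graph\<close>. Vertices are natural numbers; this costs no generality because everything
  below is invariant under relabeling.
\<close>

type_synonym ngraph = "nat pair_pre_digraph"

text \<open>The empty graph is not connected and has no components.\<close>

definition components :: "ngraph \<Rightarrow> ngraph set" where
  "components G =
     {H. pre_digraph.max_subgraph (with_proj G) Digraph_Component.connected (with_proj H)}"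

definition graph_union :: "ngraph \<Rightarrow> ngraph \<Rightarrow> ngraph" where
  "graph_union G H = \<lparr>pverts = pverts G \<union> pverts H, parcs = parcs G \<union> parcs H\<rparr>"

lemma with_proj_graph_union:
  "with_proj (graph_union G H) = Digraph_Component.union (with_proj G) (with_proj H)"
  by (simp add: with_proj_def graph_union_def Digraph_Component.union_def)

definition relabel_invariant :: "(ngraph \<Rightarrow> 'b) \<Rightarrow> bool" where
  "relabel_invariant \<phi> \<longleftrightarrow>
     (\<forall>G H. pair_graph G \<longrightarrow> pair_graph H \<longrightarrow> digraph_iso (with_proj G) (with_proj H) \<longrightarrow> \<phi> G = \<phi> H)"

definition additive_fun :: "(ngraph \<Rightarrow> int) \<Rightarrow> bool" where
  "additive_fun f \<longleftrightarrow>
     (\<forall>G H. pair_graph G \<longrightarrow> pair_graph H \<longrightarrow> pverts G \<inter> pverts H = {} \<longrightarrow>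
            f (graph_union G H) = f G + f H)"

definition homogeneous :: "(ngraph \<Rightarrow> bool) \<Rightarrow> bool" where
  "homogeneous P \<longleftrightarrow> (\<forall>G. pair_graph G \<longrightarrow> P G \<longrightarrow> (\<forall>H\<in>components G. P H))"

text \<open>The converse of homogeneity. Being connected is homogeneous, but lacks this property.\<close>

definition component_determined :: "(ngraph \<Rightarrow> bool) \<Rightarrow> bool" where
  "component_determined P \<longleftrightarrow> (\<forall>G. pair_graph G \<longrightarrow> (\<forall>H\<in>components G. P H) \<longrightarrow> P G)"

definition h0 :: "(nat \<Rightarrow> rat) \<Rightarrow> ngraph \<Rightarrow> rat" where
  "h0 \<omega> G = (\<Sum>H\<in>components G. \<omega> (card (pverts H)))"

text \<open>
  Indices of the functions \<open>f\<close> and of the variables \<open>y\<close> range over \<open>{1..s}\<close>; the integer vector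
  \<open>(k\<^sub>1, \<dots>, k\<^sub>s)\<close> is a finitely supported map \<open>k\<close> with \<open>keys k \<subseteq> {1..s}\<close>.
\<close>

definition graphs_with ::
  "(ngraph \<Rightarrow> bool) set \<Rightarrow> nat \<Rightarrow> (nat \<Rightarrow> ngraph \<Rightarrow> int) \<Rightarrow> nat \<Rightarrow> (nat \<Rightarrow>\<^sub>0 int) \<Rightarrow> ngraph set" where
  "graphs_with \<P> s f n k =
     {G. pair_graph G \<and> pverts G = {1..n} \<and> (\<forall>P\<in>\<P>. P G) \<and>
         (\<forall>i\<in>{1..s}. f i G = Poly_Mapping.lookup k i)}"

definition g_num ::
  "(ngraph \<Rightarrow> bool) set \<Rightarrow> nat \<Rightarrow> (nat \<Rightarrow> ngraph \<Rightarrow> int) \<Rightarrow> nat \<Rightarrow> (nat \<Rightarrow>\<^sub>0 int) \<Rightarrow> nat" where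
  "g_num \<P> s f n k = card {G \<in> graphs_with \<P> s f n k. Digraph_Component.connected (with_proj G)}"

text \<open>
  Both coefficient rings are monoid algebras over the rationals. In \<open>yz_ring\<close> a monomial is a pair
  of exponent vectors, the first for the \<open>y\<close> variables and the second for \<open>z\<^sub>1, z\<^sub>2, \<dots>\<close>.
  Exponents of the \<open>y\<close> variables are integers, since an additive function may take negative values.
  In \<open>yz_frac_ring\<close> the second component is the exponent of the single variable \<open>z\<close>. Treating
  powers of \<open>z\<close> symbolically, this is the ring generated by the \<open>y\<close> variables, their inverses, and
  all \<open>z\<^sup>\<nu>\<close> with \<open>\<nu>\<close> rational, where \<open>z\<^sup>\<mu> z\<^sup>\<nu> = z\<^bsup>\<mu>+\<nu>\<^esup>\<close> and distinct monomials are
  linearly independent.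
\<close>

type_synonym yz_ring = "((nat \<Rightarrow>\<^sub>0 int) \<times> (nat \<Rightarrow>\<^sub>0 nat)) \<Rightarrow>\<^sub>0 rat"
type_synonym yz_frac_ring = "((nat \<Rightarrow>\<^sub>0 int) \<times> rat) \<Rightarrow>\<^sub>0 rat"

text \<open>For each \<open>n\<close> only finitely many \<open>k\<close> contribute, so \<^const>\<open>Sum_any\<close> is the actual sum.\<close>

definition g_tilde ::
  "(ngraph \<Rightarrow> bool) set \<Rightarrow> nat \<Rightarrow> (nat \<Rightarrow> ngraph \<Rightarrow> int) \<Rightarrow> yz_ring fps" where
  "g_tilde \<P> s f = Abs_fps (\<lambda>n. if n = 0 then 0 else
     Sum_any (\<lambda>k. Poly_Mapping.single (k, Poly_Mapping.single n 1)
                     (of_nat (g_num \<P> s f n k) / fact n) when Poly_Mapping.keys k \<subseteq> {1..s}))"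

text \<open>
  The library's \<^const>\<open>fps_exp\<close> needs coefficients in a field. The composition below is the
  exponential for series with zero constant term, which is all that is needed.
\<close>

definition exp_series :: "yz_ring fps \<Rightarrow> yz_ring fps" where
  "exp_series F = fps_compose (Abs_fps (\<lambda>m. Poly_Mapping.single 0 (1 / fact m))) F"

definition tau :: "(nat \<Rightarrow> rat) \<Rightarrow> yz_ring \<Rightarrow> yz_frac_ring" where
  "tau \<omega> p = (\<Sum>(k, a)\<in>Poly_Mapping.keys p.
     Poly_Mapping.single (k, \<Sum>i\<in>Poly_Mapping.keys a. \<omega> i * of_nat (Poly_Mapping.lookup a i))
       (Poly_Mapping.lookup p (k, a)))"

lemma tau_eq_sum:
  assumes "finite A" and "Poly_Mapping.keys p \<subseteq> A"
  shows "tau \<omega> p = (\<Sum>(k, a)\<in>A.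
    Poly_Mapping.single (k, \<Sum>i\<in>Poly_Mapping.keys a. \<omega> i * of_nat (Poly_Mapping.lookup a i))
      (Poly_Mapping.lookup p (k, a)))"
  unfolding tau_def using assms
  by (intro sum.mono_neutral_left) (auto simp: in_keys_iff)

lemma tau_add: "tau \<omega> (p + q) = tau \<omega> p + tau \<omega> q"
  using keys_add[of p q]
  by (simp add: tau_eq_sum[of "Poly_Mapping.keys p \<union> Poly_Mapping.keys q"] lookup_add single_add
      sum.distrib case_prod_unfold)

lemma tau_single:
  "tau \<omega> (Poly_Mapping.single (k, a) c) =
     Poly_Mapping.single (k, \<Sum>i\<in>Poly_Mapping.keys a. \<omega> i * of_nat (Poly_Mapping.lookup a i)) c"
  by (subst tau_eq_sum[of "{(k, a)}"]) auto

lemma tau_zero: "tau \<omega> 0 = 0"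
  by (simp add: tau_def)

lemma tau_one: "tau \<omega> 1 = 1"
  using tau_single[of \<omega> 0 0 1] by (simp flip: zero_prod_def)

lemma weight_eq_sum:
  fixes \<omega> :: "nat \<Rightarrow> rat"
  assumes "finite A" and "Poly_Mapping.keys a \<subseteq> A"
  shows "(\<Sum>i\<in>Poly_Mapping.keys a. \<omega> i * of_nat (Poly_Mapping.lookup a i)) =
         (\<Sum>i\<in>A. \<omega> i * of_nat (Poly_Mapping.lookup a i))"
  using assms by (intro sum.mono_neutral_left) (auto simp: in_keys_iff)

lemma weight_add:
  fixes \<omega> :: "nat \<Rightarrow> rat"
  shows "(\<Sum>i\<in>Poly_Mapping.keys (a + b). \<omega> i * of_nat (Poly_Mapping.lookup (a + b) i)) =
         (\<Sum>i\<in>Poly_Mapping.keys a. \<omega> i * of_nat (Poly_Mapping.lookup a i)) +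
         (\<Sum>i\<in>Poly_Mapping.keys b. \<omega> i * of_nat (Poly_Mapping.lookup b i))"
  unfolding weight_eq_sum[OF finite_UnI[OF finite_keys finite_keys] keys_add]
    weight_eq_sum[of "Poly_Mapping.keys a \<union> Poly_Mapping.keys b" a, simplified]
    weight_eq_sum[of "Poly_Mapping.keys a \<union> Poly_Mapping.keys b" b, simplified]
  by (simp add: lookup_add ring_distribs sum.distrib)

lemma tau_sum: "tau \<omega> (\<Sum>x\<in>A. h x) = (\<Sum>x\<in>A. tau \<omega> (h x))"
  by (induction A rule: infinite_finite_induct) (simp_all add: tau_zero tau_add)

lemma tau_mult: "tau \<omega> (p * q) = tau \<omega> p * tau \<omega> q"
proof -
  have mono: "tau \<omega> (Poly_Mapping.single m c * Poly_Mapping.single m' c') =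
      tau \<omega> (Poly_Mapping.single m c) * tau \<omega> (Poly_Mapping.single m' c')" for m m' c c'
    by (cases m; cases m') (simp add: mult_single tau_single weight_add)
  have p: "p = (\<Sum>m\<in>Poly_Mapping.keys p. Poly_Mapping.single m (Poly_Mapping.lookup p m))"
    for p :: yz_ring
    by (rule poly_mapping_eqI)
      (simp add: lookup_sum lookup_single when_def in_keys_iff)
  show ?thesis
    by (rule subst[OF p[symmetric], of _ p], rule subst[OF p[symmetric], of _ q])
      (simp add: sum_product tau_sum mono)
qed

definition tau_fps :: "(nat \<Rightarrow> rat) \<Rightarrow> yz_ring fps \<Rightarrow> yz_frac_ring fps" where
  "tau_fps \<omega> F = Abs_fps (\<lambda>n. tau \<omega> (fps_nth F n))"

end

theory Submission
  imports Defs
begin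

text \<open>
  Weight a graph \<open>G\<close> by the monomial \<open>y\<^bsup>f(G)\<^esup> z\<^bsup>h\<^sub>0(G)\<^esup>\<close>, which is multiplicative over disjoint unions.
  Splitting off the component of a distinguished vertex \<open>v\<close> from a graph on \<open>{v} \<union> W\<close> expresses the
  total weight on \<open>m + 1\<close> vertices through the connected weights:
  \<open>T\<^bsub>m+1\<^esub> = \<Sum>\<^sub>i (m choose i) C\<^bsub>i+1\<^esub> T\<^bsub>m-i\<^esub>\<close>. The coefficients of \<open>exp g\<close> satisfy the same recursion
  because \<open>(exp g)' = g' exp g\<close>. Induction over arbitrary finite vertex sets, rather than over
  \<open>{1..n}\<close>, means that relabelling is needed for connected graphs only.
\<close>

section \<open>Power series recurrence and binomial sums\<close>

text \<open>The hypothesis on \<open>c\<close> says that the outer series E is its own derivative,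
  so the chain rule gives (E o F)' = F' (E o F), here read at x^m. Multiplying by
  \<open>Suc i\<close> instead of dividing keeps this valid in every commutative ring.\<close>

lemma fps_compose_exponential_recurrence:
  includes fps_syntax
  fixes c :: "nat \<Rightarrow> 'a::comm_ring_1"
  assumes c: "\<And>i. of_nat (Suc i) * c (Suc i) = c i" and F0: "F $ 0 = 0"
  shows "of_nat (Suc m) * fps_compose (Abs_fps c) F $ Suc m =
    (\<Sum>i=0..m. of_nat (Suc i) * F $ Suc i * fps_compose (Abs_fps c) F $ (m - i))"
proof -
  have step: "of_nat (Suc m) * (F ^ Suc i) $ Suc m = of_nat (Suc i) * (F ^ i * fps_deriv F) $ m" for i
  proof -
    have "of_nat (Suc m) * (F ^ Suc i) $ Suc m = fps_deriv (F ^ Suc i) $ m"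
      by (simp only: fps_deriv_nth Suc_eq_plus1)
    also have "\<dots> = (fps_const (of_nat (Suc i)) * (F ^ i * fps_deriv F)) $ m"
      unfolding fps_deriv_power by (simp only: diff_Suc_1 mult.assoc mult.commute[of "fps_deriv F"])
    finally show ?thesis
      by (simp only: fps_mult_left_const_nth)
  qed
  have "of_nat (Suc m) * fps_compose (Abs_fps c) F $ Suc m =
      (\<Sum>i=0..Suc m. c i * (of_nat (Suc m) * (F ^ i) $ Suc m))"
    by (simp only: fps_compose_nth fps_nth_Abs_fps sum_distrib_left mult.left_commute)
  \<comment> \<open>The term i = 0 drops out because F^0 = 1 has no coefficient at
    \<open>Suc m\<close>.\<close>
  also have "\<dots> = (\<Sum>i=0..m. c (Suc i) * (of_nat (Suc m) * (F ^ Suc i) $ Suc m))"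
    by (subst sum.atLeast0_atMost_Suc_shift) (simp del: power_Suc of_nat_Suc)
  also have "\<dots> = (\<Sum>i=0..m. c i * (F ^ i * fps_deriv F) $ m)"
  proof (rule sum.cong[OF refl])
    fix i
    have "c (Suc i) * (of_nat (Suc m) * (F ^ Suc i) $ Suc m) =
        (of_nat (Suc i) * c (Suc i)) * (F ^ i * fps_deriv F) $ m"
      unfolding step by (simp only: mult_ac)
    then show "c (Suc i) * (of_nat (Suc m) * (F ^ Suc i) $ Suc m) = c i * (F ^ i * fps_deriv F) $ m"
      unfolding c .
  qed
  also have "\<dots> = (\<Sum>i=0..m. \<Sum>j=0..m. c i * (F ^ i $ j * fps_deriv F $ (m - j)))"
    by (simp only: fps_mult_nth sum_distrib_left)
  also have "\<dots> = (\<Sum>j=0..m. \<Sum>i=0..m. c i * (F ^ i $ j * fps_deriv F $ (m - j)))"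
    by (rule sum.swap)
  also have "\<dots> = (\<Sum>j=0..m. fps_compose (Abs_fps c) F $ j * fps_deriv F $ (m - j))"
  proof (rule sum.cong[OF refl])
    fix j assume j: "j \<in> {0..m}"
    \<comment> \<open>Since F has no constant term, F^i starts at x^i at the earliest. The terms
      with i > j vanish, which leaves exactly the range in the definition of the
      composition.\<close>
    have "(\<Sum>i=0..m. c i * (F ^ i $ j * fps_deriv F $ (m - j))) =
        (\<Sum>i=0..j. c i * (F ^ i $ j * fps_deriv F $ (m - j)))"
      using j startsby_zero_power_prefix[OF F0] by (intro sum.mono_neutral_right) auto
    then show "(\<Sum>i=0..m. c i * (F ^ i $ j * fps_deriv F $ (m - j))) =
        fps_compose (Abs_fps c) F $ j * fps_deriv F $ (m - j)"
      by (simp add: fps_compose_nth sum_distrib_right mult.assoc del: fps_deriv_nth)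
  qed
  also have "\<dots> = (fps_compose (Abs_fps c) F * fps_deriv F) $ m"
    by (simp only: fps_mult_nth)
  also have "\<dots> = (fps_deriv F * fps_compose (Abs_fps c) F) $ m"
    by (simp only: mult.commute)
  also have "\<dots> = (\<Sum>i=0..m. of_nat (Suc i) * F $ Suc i * fps_compose (Abs_fps c) F $ (m - i))"
    by (simp add: fps_mult_nth)
  finally show ?thesis .
qed

text \<open>Classifying the subsets by size turns the sum over possible vertex sets of a component
  into the binomial sum of an exponential recurrence.\<close>

lemma sum_Pow_card:
  fixes h :: "nat \<Rightarrow> 'a::comm_semiring_1"
  assumes "finite A"
  shows "(\<Sum>S\<in>Pow A. h (card S)) = (\<Sum>i=0..card A. of_nat (card A choose i) * h i)"
proof -
  have "(\<Sum>S\<in>Pow A. h (card S)) = (\<Sum>i=0..card A. \<Sum>S | S \<in> Pow A \<and> card S = i. h (card S))"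
    using assms by (intro sum.group[symmetric]) (auto intro: card_mono)
  also have "\<dots> = (\<Sum>i=0..card A. of_nat (card A choose i) * h i)"
    using n_subsets[OF assms] by simp
  finally show ?thesis .
qed

section \<open>Subgraphs, connectedness and components\<close>

abbreviation conn :: "ngraph \<Rightarrow> bool" where
  "conn H \<equiv> Digraph_Component.connected (with_proj H)"

abbreviation subg :: "ngraph \<Rightarrow> ngraph \<Rightarrow> bool" where
  "subg H G \<equiv> subgraph (with_proj H) (with_proj G)"

lemma subg_iff:
  "subg H G \<longleftrightarrow> pverts H \<subseteq> pverts G \<and> parcs H \<subseteq> parcs G \<and> pair_wf_digraph G \<and> pair_wf_digraph H"
  by (auto simp: subgraph_def wf_digraph_wp_iff compatibleI_with_proj)

lemma subg_trans: "subg H K \<Longrightarrow> subg K G \<Longrightarrow> subg H G"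
  by (rule subgraph_trans)

lemma subg_antisym: "subg H G \<Longrightarrow> subg G H \<Longrightarrow> G = H"
  by (auto simp: subg_iff intro!: pair_pre_digraph.equality)

text \<open>\<open>max_subgraph\<close> ranges over all digraphs, with arbitrary head and tail maps.
  A subgraph of \<open>with_proj G\<close> inherits the projections from it, so it is again of the
  form \<open>with_proj\<close>, and maximality can be tested within the type
  \<open>ngraph\<close>.\<close>

lemma components_iff:
  "H \<in> components G \<longleftrightarrow> subg H G \<and> conn H \<and> (\<forall>H'. subg H H' \<longrightarrow> subg H' G \<longrightarrow> conn H' \<longrightarrow> H' = H)"
    (is "?L \<longleftrightarrow> ?R")
proof
  assume ?L
  then have max: "subg H G" "conn H"
    "\<And>X. X \<noteq> with_proj H \<Longrightarrow> subgraph (with_proj H) X \<Longrightarrow> subgraph X (with_proj G) \<Longrightarrow>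
       \<not> Digraph_Component.connected X"
    by (auto simp: components_def pre_digraph.max_subgraph_def)
  show ?R
  proof (intro conjI allI impI max(1,2))
    fix H' assume "subg H H'" "subg H' G" "conn H'"
    then have "with_proj H' = with_proj H" using max(3) by blast
    then show "H' = H" by (simp add: with_proj_def pair_pre_digraph.equality)
  qed
next
  assume R: ?R
  have "X = with_proj H" if "subgraph (with_proj H) X" "subgraph X (with_proj G)"
    "Digraph_Component.connected X" for X :: "(nat, nat \<times> nat) pre_digraph"
  proof -
    have X: "X = with_proj \<lparr>pverts = verts X, parcs = arcs X\<rparr>"
      using that(2) by (auto simp: subgraph_def compatible_def with_proj_def)
    show ?thesis using that R by (subst X) (metis X)
  qed
  with R show ?L
    by (auto simp: components_def pre_digraph.max_subgraph_def)
qed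

text \<open>A subgraph of a symmetric digraph need not be symmetric, hence the symmetric closure.\<close>

lemma conn_iff:
  assumes "pair_wf_digraph H"
  shows "conn H \<longleftrightarrow>
    pverts H \<noteq> {} \<and> (\<forall>u\<in>pverts H. \<forall>v\<in>pverts H. (u, v) \<in> (parcs H \<union> (parcs H)\<inverse>)\<^sup>*)"
proof -
  interpret H: pair_wf_digraph H by fact
  have parcs: "parcs (mk_symmetric (with_proj H)) = parcs H \<union> (parcs H)\<inverse>"
    by (force simp: parcs_mk_symmetric)
  have wf: "pair_wf_digraph (mk_symmetric (with_proj H))"
    by (rule H.wellformed_mk_symmetric)
  \<comment> \<open>Membership of u takes care of the empty path: \<open>reachable\<close> is
    reflexive only at vertices, whereas the reflexive transitive closure is reflexive
    everywhere.\<close>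
  have "u \<rightarrow>\<^sup>*\<^bsub>with_proj (mk_symmetric (with_proj H))\<^esub> v \<longleftrightarrow> (u, v) \<in> (parcs H \<union> (parcs H)\<inverse>)\<^sup>*"
    if "u \<in> pverts H" for u v
  proof
    assume "(u, v) \<in> (parcs H \<union> (parcs H)\<inverse>)\<^sup>*"
    then show "u \<rightarrow>\<^sup>*\<^bsub>with_proj (mk_symmetric (with_proj H))\<^esub> v"
      using that
      by induction (auto simp: reachable_def parcs dest: H.in_arcsD1 H.in_arcsD2
        intro: rtrancl_on_into_rtrancl_on)
  qed (auto dest: reachable_rtranclI simp: parcs)
  then show ?thesis
    by (auto simp: Digraph_Component.connected_def strongly_connected_def)
qed

lemma conn_nonempty: "conn H \<Longrightarrow> pverts H \<noteq> {}"
  by (auto simp: Digraph_Component.connected_def strongly_connected_def)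

lemma component_simps:
  assumes "H \<in> components G"
  shows "pverts H \<noteq> {}" "pverts H \<subseteq> pverts G" "parcs H \<subseteq> parcs G"
  using assms conn_nonempty by (auto simp: components_iff subg_iff)

section \<open>Disjoint unions and their components\<close>

lemma pverts_graph_union [simp]: "pverts (graph_union G H) = pverts G \<union> pverts H"
  and parcs_graph_union [simp]: "parcs (graph_union G H) = parcs G \<union> parcs H"
  by (simp_all add: graph_union_def)

lemma graph_union_commute: "graph_union G H = graph_union H G"
  by (auto simp: graph_union_def)

lemma pair_graph_iff:
  "pair_graph G \<longleftrightarrow> finite (pverts G) \<and> parcs G \<subseteq> pverts G \<times> pverts G \<and> sym (parcs G) \<and> irrefl (parcs G)"
  (is "?L \<longleftrightarrow> ?R")
proof
  assume ?L
  then interpret pair_graph G .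
  show ?R using pair_finite_verts in_arcsD1 in_arcsD2 pair_no_loops pair_sym_arcs
    by (force simp: symmetric_def irrefl_def)
next
  assume R: ?R
  then have "finite (parcs G)" by (auto intro: finite_subset)
  with R show ?L
    by unfold_locales (auto simp: symmetric_def irrefl_def)
qed

lemma pair_graph_imp_wf: "pair_graph G \<Longrightarrow> pair_wf_digraph G"
  by (auto simp: pair_graph_iff pair_wf_digraph_def)

lemma pair_graph_graph_union:
  "pair_graph G \<Longrightarrow> pair_graph H \<Longrightarrow> pair_graph (graph_union G H)"
  by (auto simp: pair_graph_iff sym_Un irrefl_def)

lemma subg_graph_union: "pair_graph G \<Longrightarrow> pair_graph H \<Longrightarrow> subg G (graph_union G H)"
  by (auto simp: subg_iff pair_graph_graph_union pair_graph_imp_wf)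

text \<open>No arc of the union joins \<open>pverts G\<close> to \<open>pverts H\<close>, so an
  undirected walk in L that starts at v never leaves G, and by connectedness such walks reach all of
  L.\<close>

lemma connected_subgraph_of_union_meeting:
  assumes G: "pair_graph G" and H: "pair_graph H" and disj: "pverts G \<inter> pverts H = {}"
    and L: "subg L (graph_union G H)" "conn L" and v: "v \<in> pverts L" "v \<in> pverts G"
  shows "subg L G"
proof -
  have wf: "pair_wf_digraph L" using L(1) by (simp add: subg_iff)
  interpret L: pair_wf_digraph L by fact
  have arcs: "parcs L \<subseteq> parcs G \<union> parcs H" using L(1) by (simp add: subg_iff)
  have GH: "parcs G \<subseteq> pverts G \<times> pverts G" "parcs H \<subseteq> pverts H \<times> pverts H"
    using G H by (simp_all add: pair_graph_iff)
  have "u \<in> pverts G" if "u \<in> pverts L" for u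
  proof -
    have "(v, u) \<in> (parcs L \<union> (parcs L)\<inverse>)\<^sup>*"
      using L(2) v(1) that by (simp add: conn_iff[OF wf])
    then show ?thesis
      using v(2) by induction (use arcs GH disj in blast)+
  qed
  then have "pverts L \<subseteq> pverts G" by blast
  moreover have "parcs L \<subseteq> parcs G"
    using arcs GH disj \<open>pverts L \<subseteq> pverts G\<close> L.in_arcsD1 by fast
  ultimately show ?thesis using wf pair_graph_imp_wf[OF G] by (simp add: subg_iff)
qed

lemma connected_subgraph_of_union:
  assumes G: "pair_graph G" and H: "pair_graph H" and disj: "pverts G \<inter> pverts H = {}"
    and L: "subg L (graph_union G H)" "conn L"
  shows "subg L G \<or> subg L H"
proof -
  obtain v where v: "v \<in> pverts L" using conn_nonempty[OF L(2)] by blast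
  then have "v \<in> pverts G \<or> v \<in> pverts H" using L(1) by (auto simp: subg_iff)
  then show ?thesis
    using connected_subgraph_of_union_meeting[OF G H disj L v]
      connected_subgraph_of_union_meeting[OF H G _ _ L(2) v] disj L(1)
    by (auto simp: Int_commute graph_union_commute)
qed

text \<open>Every connected K between L and the union shares a vertex with G, hence lies inside G.
  So a connected L competes for maximality against the same subgraphs in both graphs.\<close>

lemma component_graph_union_iff:
  assumes G: "pair_graph G" and H: "pair_graph H" and disj: "pverts G \<inter> pverts H = {}"
    and L: "subg L G"
  shows "L \<in> components (graph_union G H) \<longleftrightarrow> L \<in> components G"
proof -
  have "subg K G" if K: "subg L K" "subg K (graph_union G H)" "conn L" "conn K" for K
  proof -
    obtain v where "v \<in> pverts L" using conn_nonempty K(3) by blast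
    then have "v \<in> pverts K" "v \<in> pverts G" using K(1) L by (auto simp: subg_iff)
    then show ?thesis using connected_subgraph_of_union_meeting[OF G H disj K(2,4)] by blast
  qed
  then show ?thesis
    using L subg_trans[OF _ subg_graph_union[OF G H]] unfolding components_iff by blast
qed

lemma components_graph_union:
  assumes G: "pair_graph G" and H: "pair_graph H" and disj: "pverts G \<inter> pverts H = {}"
  shows "components (graph_union G H) = components G \<union> components H"
proof -
  have disj': "pverts H \<inter> pverts G = {}" using disj by blast
  have "L \<in> components (graph_union G H) \<longleftrightarrow> L \<in> components G \<union> components H" for L
  proof (cases "subg L G \<or> subg L H")
    case True
    have "\<not> (L \<in> components G \<and> subg L H)" "\<not> (L \<in> components H \<and> subg L G)"
      using disj component_simps[of L] by (fastforce simp: subg_iff)+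
    then show ?thesis using True
      component_graph_union_iff[OF G H disj, of L] component_graph_union_iff[OF H G disj', of L]
      by (auto simp: graph_union_commute components_iff)
  next
    case False
    then show ?thesis using connected_subgraph_of_union[OF G H disj, of L] by (auto simp: components_iff)
  qed
  then show ?thesis by blast
qed

lemma disjoint_components:
  assumes "pverts G \<inter> pverts H = {}"
  shows "components G \<inter> components H = {}"
  using assms component_simps(1,2) by fastforce

lemma finite_subgraphs_on:
  assumes "finite V"
  shows "finite {G :: ngraph. pverts G \<subseteq> V \<and> parcs G \<subseteq> V \<times> V}"
proof -
  have "{G :: ngraph. pverts G \<subseteq> V \<and> parcs G \<subseteq> V \<times> V} \<subseteq>
      (\<lambda>(U, R). \<lparr>pverts = U, parcs = R\<rparr>) ` (Pow V \<times> Pow (V \<times> V))"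
    by (force intro!: image_eqI[of G _ "(pverts G, parcs G)" for G] simp: pair_pre_digraph.equality)
  then show ?thesis using assms by (auto intro: finite_subset)
qed

lemma finite_components:
  assumes "pair_graph G"
  shows "finite (components G)"
proof (rule finite_subset)
  show "components G \<subseteq> {H. pverts H \<subseteq> pverts G \<and> parcs H \<subseteq> pverts G \<times> pverts G}"
    using assms component_simps(2,3) by (fastforce simp: pair_graph_iff)
  show "finite {H :: ngraph. pverts H \<subseteq> pverts G \<and> parcs H \<subseteq> pverts G \<times> pverts G}"
    using assms by (intro finite_subgraphs_on) (simp add: pair_graph_iff)
qed

lemma components_connected:
  assumes "pair_graph G" "conn G"
  shows "components G = {G}"
proof -
  have "subg G G" using pair_graph_imp_wf[OF assms(1)] by (simp add: subg_iff)
  then show ?thesis using assms(2) subg_antisym by (auto simp: components_iff)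
qed

lemma components_no_verts:
  assumes "pverts G = {}"
  shows "components G = {}"
  using assms component_simps(1,2) by blast

lemma h0_graph_union:
  assumes "pair_graph G" "pair_graph H" "pverts G \<inter> pverts H = {}"
  shows "h0 \<omega> (graph_union G H) = h0 \<omega> G + h0 \<omega> H"
  using assms by (simp add: h0_def components_graph_union disjoint_components finite_components
    sum.union_disjoint)

lemma h0_connected: "pair_graph G \<Longrightarrow> conn G \<Longrightarrow> h0 \<omega> G = \<omega> (card (pverts G))"
  by (simp add: h0_def components_connected)

section \<open>Splitting off the component of a vertex\<close>

text \<open>Let S be the set of vertices reachable from v. By symmetry of G no arc leaves or enters
  S, so G falls apart into H on S and K on the remaining vertices.\<close>

lemma split_off_component:
  assumes G: "pair_graph G" and v: "v \<in> pverts G"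
  obtains H K where "pair_graph H" "pair_graph K" "conn H" "v \<in> pverts H"
    "pverts H \<inter> pverts K = {}" "graph_union H K = G"
proof -
  define S where "S = (parcs G)\<^sup>* `` {v}"
  define H where "H = \<lparr>pverts = S, parcs = parcs G \<inter> S \<times> S\<rparr>"
  \<comment> \<open>Removing the arcs inside S, rather than restricting to the complement, makes
    \<open>graph_union H K = G\<close> immediate. That the remaining arcs avoid S altogether is the
    content of \<open>closed\<close>.\<close>
  define K where "K = \<lparr>pverts = pverts G - S, parcs = parcs G - S \<times> S\<rparr>"
  have G': "finite (pverts G)" "parcs G \<subseteq> pverts G \<times> pverts G" "sym (parcs G)" "irrefl (parcs G)"
    using G by (simp_all add: pair_graph_iff)
  have S: "S \<subseteq> pverts G"
  proof
    fix u assume "u \<in> S"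
    then have "(v, u) \<in> (parcs G)\<^sup>*" by (simp add: S_def)
    then show "u \<in> pverts G" by induction (use v G' in auto)
  qed
  have closed: "a \<in> S \<longleftrightarrow> b \<in> S" if "(a, b) \<in> parcs G" for a b
    using that symD[OF G'(3) that] by (auto simp: S_def intro: rtrancl_into_rtrancl)
  have pH: "pair_graph H" using G' S by (auto simp: pair_graph_iff H_def sym_def irrefl_def finite_subset)
  have pK: "pair_graph K" using G' closed by (auto simp: pair_graph_iff K_def sym_def irrefl_def)
  \<comment> \<open>Every vertex on a path from v is itself reachable from v, so the path uses arcs
    of H only.\<close>
  have reach: "(v, u) \<in> (parcs H)\<^sup>*" if "u \<in> S" for u
  proof -
    have "(v, u) \<in> (parcs G)\<^sup>*" using that by (simp add: S_def)
    then show ?thesis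
    proof induction
      case (step y z)
      then have "y \<in> S" "z \<in> S" by (auto simp: S_def)
      with step show ?case by (auto simp: H_def intro: rtrancl_into_rtrancl)
    qed simp
  qed
  have "sym (parcs H)" using pH by (simp add: pair_graph_iff)
  then have sym: "sym ((parcs H)\<^sup>*)" "parcs H \<union> (parcs H)\<inverse> = parcs H"
    by (auto intro: sym_rtrancl dest: symD)
  have "v \<in> S" by (simp add: S_def)
  have "(u, w) \<in> (parcs H)\<^sup>*" if "u \<in> S" "w \<in> S" for u w
    using symD[OF sym(1) reach[OF that(1)]] reach[OF that(2)] by (rule rtrancl_trans)
  then have "conn H"
    unfolding conn_iff[OF pair_graph_imp_wf[OF pH]] sym(2) using \<open>v \<in> S\<close> by (auto simp: H_def)
  moreover have "graph_union H K = G"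
    using S by (auto simp: graph_union_def H_def K_def intro!: pair_pre_digraph.equality)
  ultimately show ?thesis
    using that[OF pH pK] \<open>v \<in> S\<close> by (auto simp: H_def K_def)
qed

text \<open>H and H' are connected subgraphs of the same union and both contain v, so each lies
  inside the other. K is then what remains of the union.\<close>

lemma split_off_component_unique:
  assumes HK: "pair_graph H" "pair_graph K" "conn H" "v \<in> pverts H" "pverts H \<inter> pverts K = {}"
    and HK': "pair_graph H'" "pair_graph K'" "conn H'" "v \<in> pverts H'" "pverts H' \<inter> pverts K' = {}"
    and eq: "graph_union H K = graph_union H' K'"
  shows "H = H' \<and> K = K'"
proof -
  have "subg H H'"
    using subg_graph_union[OF HK(1,2)] unfolding eq
    by (rule connected_subgraph_of_union_meeting[OF HK'(1,2,5) _ HK(3,4) HK'(4)])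
  moreover have "subg H' H"
    using subg_graph_union[OF HK'(1,2)] unfolding eq[symmetric]
    by (rule connected_subgraph_of_union_meeting[OF HK(1,2,5) _ HK'(3,4) HK(4)])
  ultimately have H: "H = H'" by (rule subg_antisym[rotated])
  have complement: "pverts K = pverts (graph_union H K) - pverts H \<and> parcs K = parcs (graph_union H K) - parcs H"
    if "pair_graph H" "pair_graph K" "pverts H \<inter> pverts K = {}" for H K
  proof
    show "pverts K = pverts (graph_union H K) - pverts H" using that(3) by auto
    have "parcs H \<inter> parcs K = {}" using that by (fastforce simp: pair_graph_iff)
    then show "parcs K = parcs (graph_union H K) - parcs H" by auto
  qed
  have "pverts K = pverts K' \<and> parcs K = parcs K'"
    using complement[OF HK(1,2,5)] complement[OF HK'(1,2,5)] eq H by metis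
  with H show ?thesis by (simp add: pair_pre_digraph.equality)
qed

section \<open>Relabelling along injective maps\<close>

definition relabel :: "(nat \<Rightarrow> nat) \<Rightarrow> ngraph \<Rightarrow> ngraph" where
  "relabel h G = \<lparr>pverts = h ` pverts G, parcs = map_prod h h ` parcs G\<rparr>"

lemma pverts_relabel: "pverts (relabel h G) = h ` pverts G"
  by (simp add: relabel_def)

lemma relabel_pair_graph:
  assumes "pair_graph G" "inj_on h (pverts G)"
  shows "pair_graph (relabel h G)"
  using assms by (fastforce simp: pair_graph_iff relabel_def sym_def irrefl_def inj_on_def)

lemma
  assumes "pair_graph G" "inj_on h (pverts G)"
  shows digraph_iso_relabel: "digraph_iso (with_proj G) (with_proj (relabel h G))"
    and conn_relabel: "conn G \<Longrightarrow> conn (relabel h G)"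
proof -
  interpret pair_graph G by fact
  \<comment> \<open>Choosing the projections as head and tail maps of the image makes it a digraph
    of the form \<open>with_proj\<close> again.\<close>
  let ?f = "\<lparr>iso_verts = h, iso_arcs = map_prod h h, iso_head = snd, iso_tail = fst\<rparr>"
  have "inj_on (map_prod h h) (pverts G \<times> pverts G)"
    using assms(2) by (intro map_prod_inj_on)
  moreover have "parcs G \<subseteq> pverts G \<times> pverts G"
    using assms(1) by (simp add: pair_graph_iff)
  ultimately have "inj_on (map_prod h h) (parcs G)"
    by (rule inj_on_subset)
  then have iso: "pre_digraph.digraph_isomorphism (with_proj G) ?f"
    using assms(2) by (auto simp: pre_digraph.digraph_isomorphism_def wf_digraph_wp_iff
      pair_graph_imp_wf[OF assms(1)])
  have eq: "with_proj (relabel h G) = app_iso ?f (with_proj G)"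
    by (simp add: with_proj_def relabel_def app_iso_def)
  show "digraph_iso (with_proj G) (with_proj (relabel h G))"
    unfolding digraph_iso_def eq using iso by blast
  show "conn (relabel h G)" if "conn G"
    unfolding eq using that iso by (rule connectedI_app_iso)
qed

lemma relabel_relabel:
  assumes "pair_graph G" "\<And>x. x \<in> pverts G \<Longrightarrow> g (h x) = x"
  shows "relabel g (relabel h G) = G"
proof -
  have "map_prod g g (map_prod h h e) = e" if "e \<in> parcs G" for e
    using that assms by (cases e) (auto simp: pair_graph_iff)
  then show ?thesis
    using assms(2) by (intro pair_pre_digraph.equality) (simp_all add: relabel_def image_image)
qed

section \<open>Weights of the graphs in a class\<close>

locale graph_class =
  fixes \<P> :: "(ngraph \<Rightarrow> bool) set"
    and s :: nat
    and f :: "nat \<Rightarrow> ngraph \<Rightarrow> int"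
    and \<omega> :: "nat \<Rightarrow> rat"
  assumes props_invariant: "\<And>P. P \<in> \<P> \<Longrightarrow> relabel_invariant P"
    and props_homogeneous: "\<And>P. P \<in> \<P> \<Longrightarrow> homogeneous P"
    and props_determined: "\<And>P. P \<in> \<P> \<Longrightarrow> component_determined P"
    and funs_invariant: "\<And>i. i \<in> {1..s} \<Longrightarrow> relabel_invariant (f i)"
    and funs_additive: "\<And>i. i \<in> {1..s} \<Longrightarrow> additive_fun (f i)"
begin

definition graphs_on :: "nat set \<Rightarrow> ngraph set" where
  "graphs_on V = {G. pair_graph G \<and> pverts G = V \<and> (\<forall>P\<in>\<P>. P G)}"

definition connected_graphs_on :: "nat set \<Rightarrow> ngraph set" where
  "connected_graphs_on V = {G \<in> graphs_on V. conn G}"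

definition fvec :: "ngraph \<Rightarrow> (nat \<Rightarrow>\<^sub>0 int)" where
  "fvec G = (\<Sum>i\<in>{1..s}. Poly_Mapping.single i (f i G))"

text \<open>The weight is taken in the target ring of \<open>tau\<close>, so the exponent of z is
  the rational number \<open>h0 \<omega> G\<close> itself and the component sizes need not be
  recorded separately.\<close>

definition monomial_of :: "ngraph \<Rightarrow> yz_frac_ring" where
  "monomial_of G = Poly_Mapping.single (fvec G, h0 \<omega> G) 1"

lemma lookup_fvec: "Poly_Mapping.lookup (fvec G) i = (if i \<in> {1..s} then f i G else 0)"
  by (simp add: fvec_def lookup_sum lookup_single when_def)

lemma fvec_eq_iff:
  "fvec G = k \<longleftrightarrow> Poly_Mapping.keys k \<subseteq> {1..s} \<and> (\<forall>i\<in>{1..s}. f i G = Poly_Mapping.lookup k i)"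
  by (auto simp: poly_mapping_eq_iff fun_eq_iff lookup_fvec in_keys_iff subset_iff)

lemma graphs_with_eq:
  "Poly_Mapping.keys k \<subseteq> {1..s} \<Longrightarrow> graphs_with \<P> s f n k = {G \<in> graphs_on {1..n}. fvec G = k}"
  by (auto simp: graphs_with_def graphs_on_def fvec_eq_iff)

lemma finite_graphs_on:
  assumes "finite V"
  shows "finite (graphs_on V)" "finite (connected_graphs_on V)"
proof -
  show "finite (graphs_on V)"
    by (rule finite_subset[OF _ finite_subgraphs_on[OF assms]])
      (auto simp: graphs_on_def pair_graph_iff)
  then show "finite (connected_graphs_on V)"
    by (simp add: connected_graphs_on_def)
qed

text \<open>Homogeneity and its converse together make P equivalent to its validity on all
  components, and the components of a disjoint union are those of its two parts.\<close>

lemma props_graph_union: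
  assumes "P \<in> \<P>" "pair_graph G" "pair_graph H" "pverts G \<inter> pverts H = {}"
  shows "P (graph_union G H) \<longleftrightarrow> P G \<and> P H"
  using props_homogeneous[OF assms(1)] props_determined[OF assms(1)] assms(2,3)
    pair_graph_graph_union[OF assms(2,3)] components_graph_union[OF assms(2-4)]
  unfolding homogeneous_def component_determined_def by blast

lemma monomial_of_graph_union:
  assumes "pair_graph G" "pair_graph H" "pverts G \<inter> pverts H = {}"
  shows "monomial_of (graph_union G H) = monomial_of G * monomial_of H"
proof -
  have "f i (graph_union G H) = f i G + f i H" if "i \<in> {1..s}" for i
    using funs_additive[OF that] assms by (simp add: additive_fun_def)
  then have "fvec (graph_union G H) = fvec G + fvec H"
    by (simp add: fvec_def single_add sum.distrib)
  then show ?thesis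
    using assms by (simp add: monomial_of_def mult_single h0_graph_union)
qed

text \<open>This is the base case of the induction on vertex sets. The empty graph has no
  components, so it satisfies every P vacuously; being its own disjoint union with itself, it has
  \<open>f i\<close> equal to 0 by additivity.\<close>

lemma sum_monomial_of_no_verts: "(\<Sum>G\<in>graphs_on {}. monomial_of G) = 1"
proof -
  let ?E = "\<lparr>pverts = {}, parcs = {}\<rparr> :: ngraph"
  have E: "pair_graph ?E" by (simp add: pair_graph_iff sym_def irrefl_def)
  have "P ?E" if "P \<in> \<P>" for P
    using props_determined[OF that] E by (simp add: component_determined_def components_no_verts)
  then have "graphs_on {} = {?E}"
    using E by (auto simp: graphs_on_def pair_graph_iff intro: pair_pre_digraph.equality)
  moreover have union: "graph_union ?E ?E = ?E" by (simp add: graph_union_def)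
  have "f i ?E = 0" if "i \<in> {1..s}" for i
    using funs_additive[OF that, unfolded additive_fun_def, rule_format, OF E E, unfolded union]
    by simp
  then have "fvec ?E = 0" by (simp add: fvec_def)
  ultimately show ?thesis
    by (simp add: monomial_of_def h0_def components_no_verts flip: zero_prod_def)
qed

section \<open>The recursion on vertex sets\<close>

text \<open>S collects the other vertices in the component of v and can be recovered as
  \<open>pverts H - {v}\<close>. Surjectivity is the existence of the splitting, injectivity its
  uniqueness.\<close>

lemma bij_betw_split_off_component:
  assumes "finite W" "v \<notin> W"
  shows "bij_betw (\<lambda>(S, H, K). graph_union H K)
    (SIGMA S:Pow W. connected_graphs_on (insert v S) \<times> graphs_on (W - S)) (graphs_on (insert v W))"
    (is "bij_betw ?u ?A ?B")
proof (rule bij_betwI')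
  have A: "pair_graph H \<and> pair_graph K \<and> conn H \<and> v \<in> pverts H \<and> pverts H \<inter> pverts K = {} \<and>
      (\<forall>P\<in>\<P>. P H \<and> P K) \<and> S = pverts H - {v} \<and> pverts H \<union> pverts K = insert v W"
    if "(S, H, K) \<in> ?A" for S H K
    using that assms(2) by (auto simp: connected_graphs_on_def graphs_on_def)
  show "?u x = ?u y \<longleftrightarrow> x = y" if "x \<in> ?A" "y \<in> ?A" for x y
  proof
    obtain S H K S' H' K' where x: "x = (S, H, K)" and y: "y = (S', H', K')"
      by (metis prod_cases3)
    assume "?u x = ?u y"
    then show "x = y"
      using split_off_component_unique[of H K v H' K'] A[of S H K] A[of S' H' K'] that
      by (simp add: x y)
  qed simp
  show "?u x \<in> ?B" if "x \<in> ?A" for x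
  proof -
    obtain S H K where x: "x = (S, H, K)" by (metis prod_cases3)
    have HK: "pair_graph H" "pair_graph K" "pverts H \<inter> pverts K = {}" "pverts H \<union> pverts K = insert v W"
      "\<forall>P\<in>\<P>. P H \<and> P K"
      using A[of S H K] that unfolding x by blast+
    then have "P (graph_union H K)" if "P \<in> \<P>" for P
      using props_graph_union[OF that HK(1-3)] that by blast
    then show ?thesis
      using HK(4) pair_graph_graph_union[OF HK(1,2)] by (auto simp: x graphs_on_def)
  qed
  show "\<exists>x\<in>?A. G = ?u x" if "G \<in> ?B" for G
  proof -
    have G: "pair_graph G" "pverts G = insert v W" "\<And>P. P \<in> \<P> \<Longrightarrow> P G"
      using that by (auto simp: graphs_on_def)
    obtain H K where HK: "pair_graph H" "pair_graph K" "conn H" "v \<in> pverts H"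
      "pverts H \<inter> pverts K = {}" "graph_union H K = G"
      using split_off_component[OF G(1), of v] G(2) by blast
    have "pverts H \<union> pverts K = insert v W" using G(2)[folded HK(6)] by simp
    then have verts: "pverts H - {v} \<subseteq> W" "insert v (pverts H - {v}) = pverts H"
      "W - (pverts H - {v}) = pverts K"
      using HK(4,5) assms(2) by auto
    have "P H \<and> P K" if "P \<in> \<P>" for P
      using props_graph_union[OF that HK(1,2,5)] G(3)[OF that] HK(6) by simp
    then have "(pverts H - {v}, H, K) \<in> ?A"
      using HK(1-3) verts unfolding connected_graphs_on_def graphs_on_def by auto
    then show ?thesis using HK(6) by (intro bexI[of _ "(pverts H - {v}, H, K)"]) simp_all
  qed
qed

text \<open>The weight is multiplicative along the bijection, and once S is fixed H and K are chosen
  independently, so the inner double sum factors.\<close>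

lemma sum_monomial_of_insert:
  assumes "finite W" "v \<notin> W"
  shows "(\<Sum>G\<in>graphs_on (insert v W). monomial_of G) =
    (\<Sum>S\<in>Pow W. (\<Sum>H\<in>connected_graphs_on (insert v S). monomial_of H) *
      (\<Sum>K\<in>graphs_on (W - S). monomial_of K))"
proof -
  have fin: "finite S" if "S \<in> Pow W" for S
    using that assms(1) by (auto intro: finite_subset)
  have "(\<Sum>G\<in>graphs_on (insert v W). monomial_of G) =
      (\<Sum>(S, H, K)\<in>(SIGMA S:Pow W. connected_graphs_on (insert v S) \<times> graphs_on (W - S)).
        monomial_of (graph_union H K))"
    by (subst sum.reindex_bij_betw[OF bij_betw_split_off_component[OF assms], symmetric])
      (simp add: case_prod_unfold)
  also have "\<dots> = (\<Sum>(S, H, K)\<in>(SIGMA S:Pow W. connected_graphs_on (insert v S) \<times> graphs_on (W - S)).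
        monomial_of H * monomial_of K)"
  proof (rule sum.cong[OF refl], clarify)
    fix S H K
    assume "S \<subseteq> W" "H \<in> connected_graphs_on (insert v S)" "K \<in> graphs_on (W - S)"
    then show "monomial_of (graph_union H K) = monomial_of H * monomial_of K"
      using assms(2) by (intro monomial_of_graph_union) (auto simp: connected_graphs_on_def graphs_on_def)
  qed
  also have "\<dots> = (\<Sum>S\<in>Pow W. \<Sum>(H, K)\<in>connected_graphs_on (insert v S) \<times> graphs_on (W - S).
        monomial_of H * monomial_of K)"
    using assms(1) fin by (subst sum.Sigma) (auto simp: finite_graphs_on)
  also have "\<dots> = (\<Sum>S\<in>Pow W. (\<Sum>H\<in>connected_graphs_on (insert v S). monomial_of H) *
      (\<Sum>K\<in>graphs_on (W - S). monomial_of K))"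
    by (simp add: sum_product sum.cartesian_product)
  finally show ?thesis .
qed

section \<open>Connected graphs and the coefficients of \<open>g_tilde\<close>\<close>

lemma relabel_connected_graphs_on:
  assumes "inj_on h V" "G \<in> connected_graphs_on V"
  shows "relabel h G \<in> connected_graphs_on (h ` V)" "fvec (relabel h G) = fvec G"
proof -
  have G: "pair_graph G" "inj_on h (pverts G)" "pverts G = V" "conn G" "\<And>P. P \<in> \<P> \<Longrightarrow> P G"
    using assms by (auto simp: connected_graphs_on_def graphs_on_def)
  note iso = relabel_pair_graph[OF G(1,2)] digraph_iso_relabel[OF G(1,2)]
  have "P (relabel h G)" if "P \<in> \<P>" for P
    using props_invariant[OF that] iso G(1) G(5)[OF that] unfolding relabel_invariant_def by metis
  then show "relabel h G \<in> connected_graphs_on (h ` V)"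
    using iso(1) conn_relabel[OF G(1,2,4)] G(3)
    unfolding connected_graphs_on_def graphs_on_def by (auto simp: pverts_relabel)
  have "f i (relabel h G) = f i G" if "i \<in> {1..s}" for i
    using funs_invariant[OF that] iso G(1) unfolding relabel_invariant_def by metis
  then show "fvec (relabel h G) = fvec G"
    by (simp add: fvec_def)
qed

lemma monomial_of_connected:
  "G \<in> connected_graphs_on V \<Longrightarrow> monomial_of G = Poly_Mapping.single (fvec G, \<omega> (card V)) 1"
  by (auto simp: connected_graphs_on_def graphs_on_def monomial_of_def h0_connected)

text \<open>Relabelling along h is undone by relabelling along its inverse on V. It preserves the
  weight because \<open>fvec\<close> is invariant and the exponent of z of a connected graph depends
  only on its order.\<close>

lemma sum_monomial_of_connected_relabel:
  assumes "inj_on h V"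
  shows "(\<Sum>G\<in>connected_graphs_on V. monomial_of G) = (\<Sum>G\<in>connected_graphs_on (h ` V). monomial_of G)"
proof (rule sum.reindex_bij_witness[where i = "relabel (inv_into V h)" and j = "relabel h"])
  fix G assume G: "G \<in> connected_graphs_on V"
  show "relabel (inv_into V h) (relabel h G) = G"
    using G assms by (intro relabel_relabel) (auto simp: connected_graphs_on_def graphs_on_def)
  show "relabel h G \<in> connected_graphs_on (h ` V)"
    using relabel_connected_graphs_on[OF assms G] by simp
  then show "monomial_of (relabel h G) = monomial_of G"
    using relabel_connected_graphs_on(2)[OF assms G] G assms
    by (simp add: monomial_of_connected card_image)
next
  fix G assume G: "G \<in> connected_graphs_on (h ` V)"
  show "relabel h (relabel (inv_into V h) G) = G"
    using G by (intro relabel_relabel) (auto simp: connected_graphs_on_def graphs_on_def f_inv_into_f)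
  show "relabel (inv_into V h) G \<in> connected_graphs_on V"
    using relabel_connected_graphs_on(1)[OF _ G, of "inv_into V h"] assms
    by (simp add: inj_on_inv_into)
qed

lemma g_num_eq:
  "Poly_Mapping.keys k \<subseteq> {1..s} \<Longrightarrow> g_num \<P> s f n k = card {G \<in> connected_graphs_on {1..n}. fvec G = k}"
  unfolding g_num_def graphs_with_eq
  by (rule arg_cong[where f = card]) (auto simp: connected_graphs_on_def)

text \<open>\<open>tau\<close> sends the variable with index n to the power of z with exponent
  \<open>\<omega> n\<close>, which is the z-part of the weight of any connected graph of order n. It
  remains to group these graphs by \<open>fvec\<close>.\<close>

lemma fact_tau_g_tilde:
  assumes "n > 0"
  shows "fact n * tau \<omega> (fps_nth (g_tilde \<P> s f) n) = (\<Sum>G\<in>connected_graphs_on {1..n}. monomial_of G)"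
proof -
  let ?C = "connected_graphs_on {1..n}"
  let ?K = "fvec ` ?C"
  have fin: "finite ?C" by (simp add: finite_graphs_on)
  have keys: "Poly_Mapping.keys k \<subseteq> {1..s}" if "k \<in> ?K" for k
    using that fvec_eq_iff by blast
  \<comment> \<open>An unattained vector contributes zero, either because its count vanishes or
    because its keys leave the allowed range. This confines \<open>Sum_any\<close> to the finite set
    \<open>?K\<close>.\<close>
  have "g_num \<P> s f n k = 0" if "k \<notin> ?K" "Poly_Mapping.keys k \<subseteq> {1..s}" for k
    using that by (auto simp: g_num_eq intro!: arg_cong[where f = card, of _ "{}", simplified])
  then have "(Poly_Mapping.single (k, Poly_Mapping.single n (1 :: nat)) (of_nat (g_num \<P> s f n k) / fact n :: rat)
      when Poly_Mapping.keys k \<subseteq> {1..s}) = 0" if "k \<notin> ?K" for k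
    using that by (simp add: when_def del: One_nat_def)
  then have support: "{k. (Poly_Mapping.single (k, Poly_Mapping.single n (1 :: nat)) (of_nat (g_num \<P> s f n k) / fact n :: rat)
      when Poly_Mapping.keys k \<subseteq> {1..s}) \<noteq> 0} \<subseteq> ?K"
    by blast
  have "fps_nth (g_tilde \<P> s f) n =
      Sum_any (\<lambda>k. Poly_Mapping.single (k, Poly_Mapping.single n 1) (of_nat (g_num \<P> s f n k) / fact n)
        when Poly_Mapping.keys k \<subseteq> {1..s})"
    using assms by (simp add: g_tilde_def)
  also have "\<dots> =
      (\<Sum>k\<in>?K. Poly_Mapping.single (k, Poly_Mapping.single n 1) (of_nat (g_num \<P> s f n k) / fact n)
        when Poly_Mapping.keys k \<subseteq> {1..s})"
    by (rule Sum_any.expand_superset[OF finite_imageI[OF fin] support])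
  also have "\<dots> = (\<Sum>k\<in>?K. Poly_Mapping.single (k, Poly_Mapping.single n 1) (of_nat (g_num \<P> s f n k) / fact n))"
    using keys by (intro sum.cong) (auto simp: when_def)
  finally have "tau \<omega> (fps_nth (g_tilde \<P> s f) n) =
      (\<Sum>k\<in>?K. Poly_Mapping.single (k, \<omega> n) (of_nat (g_num \<P> s f n k) / fact n))"
    by (simp add: tau_sum tau_single)
  \<comment> \<open>As a constant monomial, the factorial can be multiplied into each summand by
    \<open>mult_single\<close>, where it cancels the denominator.\<close>
  moreover have "(fact n :: yz_frac_ring) = Poly_Mapping.single 0 (fact n)"
    by (metis of_nat_fact single_of_nat)
  ultimately have "fact n * tau \<omega> (fps_nth (g_tilde \<P> s f) n) =
      (\<Sum>k\<in>?K. Poly_Mapping.single (k, \<omega> n) (of_nat (g_num \<P> s f n k)))"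
    by (simp add: sum_distrib_left mult_single)
  also have "\<dots> = (\<Sum>k\<in>?K. \<Sum>G | G \<in> ?C \<and> fvec G = k. Poly_Mapping.single (k, \<omega> n) 1)"
  proof (rule sum.cong[OF refl])
    fix k assume "k \<in> ?K"
    have "of_nat m * Poly_Mapping.single (k, \<omega> n) (1 :: rat) = Poly_Mapping.single (k, \<omega> n) (of_nat m)" for m
      by (simp add: mult_single flip: single_of_nat)
    then show "Poly_Mapping.single (k, \<omega> n) (of_nat (g_num \<P> s f n k)) =
        (\<Sum>G | G \<in> ?C \<and> fvec G = k. Poly_Mapping.single (k, \<omega> n) (1 :: rat))"
      using keys[OF \<open>k \<in> ?K\<close>] by (simp add: g_num_eq)
  qed
  also have "\<dots> = (\<Sum>k\<in>?K. \<Sum>G | G \<in> ?C \<and> fvec G = k. monomial_of G)"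
    by (intro sum.cong refl) (auto simp: monomial_of_connected)
  also have "\<dots> = (\<Sum>G\<in>?C. monomial_of G)"
    by (rule sum.image_gen[OF fin, symmetric])
  finally show ?thesis .
qed

lemma sum_monomial_of_connected:
  assumes "finite V" "V \<noteq> {}"
  shows "(\<Sum>G\<in>connected_graphs_on V. monomial_of G) =
    fact (card V) * tau \<omega> (fps_nth (g_tilde \<P> s f) (card V))"
proof -
  obtain h where "bij_betw h V {1..card V}"
    using assms(1) finite_same_card_bij[of V "{1..card V}"] by auto
  then show ?thesis
    using sum_monomial_of_connected_relabel[of h V] assms
    by (simp add: bij_betw_def fact_tau_g_tilde card_gt_0_iff)
qed

section \<open>Comparison with the exponential series\<close>

lemma tau_of_nat: "tau \<omega> (of_nat n) = of_nat n"
  by (induction n) (simp_all add: tau_zero tau_add tau_one)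

text \<open>The recurrence is obtained in the source ring and carried over coefficient by
  coefficient, since \<open>tau\<close> respects sums, products and natural numbers.\<close>

lemma tau_exp_series_recurrence:
  fixes m :: nat
  defines "t \<equiv> \<lambda>n. tau \<omega> (fps_nth (exp_series (g_tilde \<P> s f)) n)"
    and "\<phi> \<equiv> \<lambda>n. tau \<omega> (fps_nth (g_tilde \<P> s f) n)"
  shows "of_nat (Suc m) * t (Suc m) = (\<Sum>i=0..m. of_nat (Suc i) * \<phi> (Suc i) * t (m - i))"
proof -
  let ?c = "\<lambda>m. Poly_Mapping.single 0 (1 / fact m) :: yz_ring"
  have "of_nat (Suc i) * ?c (Suc i) = ?c i" for i
    by (simp only: single_of_nat[symmetric] mult_single) (simp add: field_simps del: of_nat_Suc)
  moreover have "fps_nth (g_tilde \<P> s f) 0 = 0" by (simp add: g_tilde_def)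
  ultimately have "of_nat (Suc m) * fps_nth (exp_series (g_tilde \<P> s f)) (Suc m) =
      (\<Sum>i=0..m. of_nat (Suc i) * fps_nth (g_tilde \<P> s f) (Suc i) *
        fps_nth (exp_series (g_tilde \<P> s f)) (m - i))"
    unfolding exp_series_def by (rule fps_compose_exponential_recurrence)
  then have "tau \<omega> (of_nat (Suc m) * fps_nth (exp_series (g_tilde \<P> s f)) (Suc m)) =
      tau \<omega> (\<Sum>i=0..m. of_nat (Suc i) * fps_nth (g_tilde \<P> s f) (Suc i) *
        fps_nth (exp_series (g_tilde \<P> s f)) (m - i))"
    by (rule arg_cong)
  then show ?thesis
    unfolding t_def \<phi>_def by (simp only: tau_mult tau_sum tau_of_nat)
qed

text \<open>Strong induction on the order works because W - S misses v and so is smaller than V,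
  even for empty S. The factor for \<open>insert v S\<close> is known from
  \<open>sum_monomial_of_connected\<close>.\<close>

lemma sum_monomial_of_graphs_on:
  assumes "finite V"
  shows "(\<Sum>G\<in>graphs_on V. monomial_of G) =
    fact (card V) * tau \<omega> (fps_nth (exp_series (g_tilde \<P> s f)) (card V))"
  using assms
proof (induction "card V" arbitrary: V rule: less_induct)
  case less
  define t where "t = (\<lambda>n. tau \<omega> (fps_nth (exp_series (g_tilde \<P> s f)) n))"
  define \<phi> where "\<phi> = (\<lambda>n. tau \<omega> (fps_nth (g_tilde \<P> s f) n))"
  show ?case
  proof (cases "V = {}")
    case True
    have "fps_nth (exp_series (g_tilde \<P> s f)) 0 = 1"
      by (simp add: exp_series_def)
    then show ?thesis by (simp add: True sum_monomial_of_no_verts tau_one)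
  next
    case False
    then obtain v W where V: "V = insert v W" "v \<notin> W" by (meson ex_in_conv mk_disjoint_insert)
    with less.prems have W: "finite W" by simp
    define m where "m = card W"
    have card: "card V = Suc m" using V W by (simp add: m_def)
    have fin: "finite S" if "S \<subseteq> W" for S using that W by (rule finite_subset)
    have summand: "(\<Sum>H\<in>connected_graphs_on (insert v S). monomial_of H) *
        (\<Sum>K\<in>graphs_on (W - S). monomial_of K) =
        fact (Suc (card S)) * \<phi> (Suc (card S)) * (fact (m - card S) * t (m - card S))"
      if S: "S \<subseteq> W" for S
    proof -
      have "v \<notin> S" using S V(2) by blast
      then have "(\<Sum>H\<in>connected_graphs_on (insert v S). monomial_of H) =
          fact (Suc (card S)) * \<phi> (Suc (card S))"
        using fin[OF S] by (simp add: sum_monomial_of_connected \<phi>_def del: fact_Suc)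
      moreover have "card (W - S) = m - card S"
        using S fin by (simp add: card_Diff_subset m_def)
      then have "(\<Sum>K\<in>graphs_on (W - S). monomial_of K) = fact (m - card S) * t (m - card S)"
        using less.hyps[of "W - S"] W card by (simp add: t_def)
      ultimately show ?thesis by simp
    qed
    \<comment> \<open>Here (i+1)! splits as (i+1) i!, and i! (m-i)! cancels against the binomial
      coefficient up to m!. This converts the recursion for weighted counts into the one for series
      coefficients.\<close>
    have coeff: "of_nat (m choose i) * (fact (Suc i) * x * (fact (m - i) * y)) =
        fact m * (of_nat (Suc i) * x * y)" if "i \<le> m" for i and x y :: yz_frac_ring
    proof -
      have "fact i * fact (m - i) * (m choose i) = (fact m :: nat)"
        by (rule binomial_fact_lemma[OF that])
      then have "(fact i * fact (m - i) * of_nat (m choose i) :: yz_frac_ring) = fact m"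
        by (metis of_nat_fact of_nat_mult)
      then have "fact m * (of_nat (Suc i) * x * y) =
          fact i * fact (m - i) * of_nat (m choose i) * (of_nat (Suc i) * x * y)" by simp
      then show ?thesis by (simp add: fact_Suc mult_ac del: of_nat_Suc)
    qed
    have "(\<Sum>G\<in>graphs_on V. monomial_of G) =
        (\<Sum>S\<in>Pow W. fact (Suc (card S)) * \<phi> (Suc (card S)) * (fact (m - card S) * t (m - card S)))"
      using summand unfolding V(1) sum_monomial_of_insert[OF W V(2)] by (intro sum.cong) auto
    also have "\<dots> = (\<Sum>i=0..m. of_nat (m choose i) *
        (fact (Suc i) * \<phi> (Suc i) * (fact (m - i) * t (m - i))))"
      by (rule sum_Pow_card[OF W, where h = "\<lambda>i. fact (Suc i) * \<phi> (Suc i) * (fact (m - i) * t (m - i))",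
        folded m_def])
    also have "\<dots> = (\<Sum>i=0..m. fact m * (of_nat (Suc i) * \<phi> (Suc i) * t (m - i)))"
      by (intro sum.cong refl coeff) simp
    \<comment> \<open>The recurrence of the exponential series is used from right to left.\<close>
    also have "\<dots> = fact m * (of_nat (Suc m) * t (Suc m))"
      unfolding t_def \<phi>_def tau_exp_series_recurrence sum_distrib_left ..
    also have "\<dots> = fact (Suc m) * t (Suc m)"
      by (simp add: fact_Suc mult_ac del: of_nat_Suc)
    finally show ?thesis by (simp add: card t_def del: fact_Suc)
  qed
qed

section \<open>Reading off the counts\<close>

text \<open>Each graph contributes one monomial with coefficient 1, and distinct exponent pairs are
  distinct basis elements, so a coefficient of the total weight counts the graphs with that
  pair.\<close>

lemma lookup_tau_exp_series:
  "Poly_Mapping.lookup (tau \<omega> (fps_nth (exp_series (g_tilde \<P> s f)) n)) (k, \<nu>) =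
    of_nat (card {G \<in> graphs_on {1..n}. fvec G = k \<and> h0 \<omega> G = \<nu>}) / fact n"
proof -
  let ?t = "tau \<omega> (fps_nth (exp_series (g_tilde \<P> s f)) n)"
  have lookup_of_nat_mult: "Poly_Mapping.lookup (of_nat m * p) x = of_nat m * Poly_Mapping.lookup p x"
    for m and p :: yz_frac_ring and x
    by (induction m) (simp_all add: lookup_add ring_distribs)
  have "fact n * Poly_Mapping.lookup ?t (k, \<nu>) = Poly_Mapping.lookup (fact n * ?t) (k, \<nu>)"
    by (metis lookup_of_nat_mult of_nat_fact)
  also have "fact n * ?t = (\<Sum>G\<in>graphs_on {1..n}. monomial_of G)"
    using sum_monomial_of_graphs_on[of "{1..n}"] by simp
  also have "Poly_Mapping.lookup \<dots> (k, \<nu>) = (\<Sum>G\<in>graphs_on {1..n}. of_bool (fvec G = k \<and> h0 \<omega> G = \<nu>))"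
    by (simp add: lookup_sum monomial_of_def lookup_single when_def of_bool_def)
  also have "\<dots> = of_nat (card {G \<in> graphs_on {1..n}. fvec G = k \<and> h0 \<omega> G = \<nu>})"
    by (simp add: finite_graphs_on sum_of_bool_eq Int_def)
  finally show ?thesis by (simp add: field_simps)
qed

end

theorem theorem2:
  fixes \<P> :: "(ngraph \<Rightarrow> bool) set"
    and s :: nat
    and f :: "nat \<Rightarrow> ngraph \<Rightarrow> int"
    and \<omega> :: "nat \<Rightarrow> rat"
  assumes "\<And>P. P \<in> \<P> \<Longrightarrow> relabel_invariant P"
    and "\<And>P. P \<in> \<P> \<Longrightarrow> homogeneous P"
    and "\<And>P. P \<in> \<P> \<Longrightarrow> component_determined P"
    and "\<And>i. i \<in> {1..s} \<Longrightarrow> relabel_invariant (f i)"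
    and "\<And>i. i \<in> {1..s} \<Longrightarrow> additive_fun (f i)"
  shows "\<forall>n k \<nu>.
    Poly_Mapping.lookup (fps_nth (tau_fps \<omega> (exp_series (g_tilde \<P> s f))) n) (k, \<nu>) =
      (if Poly_Mapping.keys k \<subseteq> {1..s}
       then of_nat (card {G \<in> graphs_with \<P> s f n k. h0 \<omega> G = \<nu>}) / fact n
       else 0)"
proof (intro allI)
  fix n k \<nu>
  interpret graph_class \<P> s f \<omega>
    by unfold_locales (fact assms)+
  have eq: "Poly_Mapping.lookup (fps_nth (tau_fps \<omega> (exp_series (g_tilde \<P> s f))) n) (k, \<nu>) =
      of_nat (card {G \<in> graphs_on {1..n}. fvec G = k \<and> h0 \<omega> G = \<nu>}) / fact n"
    by (simp add: tau_fps_def lookup_tau_exp_series)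
  show "Poly_Mapping.lookup (fps_nth (tau_fps \<omega> (exp_series (g_tilde \<P> s f))) n) (k, \<nu>) =
      (if Poly_Mapping.keys k \<subseteq> {1..s}
       then of_nat (card {G \<in> graphs_with \<P> s f n k. h0 \<omega> G = \<nu>}) / fact n
       else 0)"
  \<comment> \<open>For keys within \<open>{1..s}\<close>, prescribing all \<open>f i\<close> is the
    same as prescribing \<open>fvec\<close>. Any other vector is the \<open>fvec\<close> of no
    graph, since \<open>fvec\<close> is supported on \<open>{1..s}\<close>.\<close>
  proof (cases "Poly_Mapping.keys k \<subseteq> {1..s}")
    case True
    then have "{G \<in> graphs_with \<P> s f n k. h0 \<omega> G = \<nu>} =
        {G \<in> graphs_on {1..n}. fvec G = k \<and> h0 \<omega> G = \<nu>}"
      by (auto simp: graphs_with_eq)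
    with True show ?thesis by (simp add: eq)
  next
    case False
    then have "{G \<in> graphs_on {1..n}. fvec G = k \<and> h0 \<omega> G = \<nu>} = {}"
      by (auto simp: fvec_eq_iff)
    with False show ?thesis by (simp only: eq) simp
  qed
qed

end
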